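(* Let $\mathscr{C}\subset\mathbb{R}^n$ be a weakly balanced graph. Then its complement $\mathbb{R}^n\smallsetminus\mathscr{C}$ is $(n-2)$-convex.
   Context: Weakly balanced graph: a locally finite polyhedral complex $\mathscr{C}$ in $\mathbb{R}^n$ of pure dimension one (so it consists of vertices and edges, each edge being a possibly unbounded interval of a line, and there are no isolated points) such that for all $w\in\mathbb{R}^n$ and all points $p\in\mathscr{C}$, either $w\cdot v_e=0$ for all edges $e$ incident on $p$, or there are two edges $e,f$ incident on $p$ with $w\cdot v_e<0<w\cdot v_f$. Here, for an edge $e$ incident on $p$, $v_e$ is any nonzero vector parallel to $e$ and pointing away from $p$. If $p$ lies in the relative interior of an edge, that edge is regarded as subdivided at $p$, giving two edges incident on $p$ with opposite directions. $k$-convexity: an open set $X\subset\mathbb{R}^n$ is $k$-convex if for every affine linear subspace $L\subset\mathbb{R}^n$ of dimension $k+1$, the map on reduced integral homology induced by inclusion, $\iota_k\colon\widetilde{H}_k(L\cap X)\to\widetilde{H}_k(X)$, is injective. *)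

theory Defs
  imports "HOL-Analysis.Analysis" "HOL-Homology.Homology"
begin

(* Cells are nonempty; the library's face_of also admits the empty face, hence the guard on
   faces, while disjoint cells meet in the empty face. *)
definition polyhedral_complex :: "'a::euclidean_space set set \<Rightarrow> bool" where
  "polyhedral_complex \<C> \<longleftrightarrow>
     (\<forall>\<sigma>\<in>\<C>. polyhedron \<sigma> \<and> \<sigma> \<noteq> {}) \<and>
     (\<forall>\<sigma>\<in>\<C>. \<forall>\<tau>. \<tau> face_of \<sigma> \<and> \<tau> \<noteq> {} \<longrightarrow> \<tau> \<in> \<C>) \<and>
     (\<forall>\<sigma>\<in>\<C>. \<forall>\<tau>\<in>\<C>. (\<sigma> \<inter> \<tau>) face_of \<sigma> \<and> (\<sigma> \<inter> \<tau>) face_of \<tau>)"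

definition pure_dimensional :: "int \<Rightarrow> 'a::euclidean_space set set \<Rightarrow> bool" where
  "pure_dimensional d \<C> \<longleftrightarrow>
     (\<forall>\<sigma>\<in>\<C>. (\<forall>\<tau>\<in>\<C>. \<sigma> \<subseteq> \<tau> \<longrightarrow> \<tau> = \<sigma>) \<longrightarrow> aff_dim \<sigma> = d)"

definition edges :: "'a::euclidean_space set set \<Rightarrow> 'a set set" where
  "edges \<C> = {e \<in> \<C>. aff_dim e = 1}"

(* An edge having p in its relative interior is subdivided at p: it contributes the two pieces
   obtained by adding p to each component of the edge minus p. *)
definition incident_edges :: "'a::euclidean_space set set \<Rightarrow> 'a \<Rightarrow> 'a set set" where
  "incident_edges \<C> p =
     {e \<in> edges \<C>. p \<in> e \<and> p \<notin> rel_interior e} \<union>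
     {insert p h |h e. e \<in> edges \<C> \<and> p \<in> rel_interior e \<and> h \<in> components (e - {p})}"

(* For an edge e with endpoint p these are all admissible choices of v_e: the nonzero vectors
   parallel to e and pointing away from p. *)
definition outward_vectors :: "'a::euclidean_space \<Rightarrow> 'a set \<Rightarrow> 'a set" where
  "outward_vectors p e = {v. v \<noteq> 0 \<and> (\<exists>t>0. p + t *\<^sub>R v \<in> e)}"

definition weakly_balanced_graph :: "'a::euclidean_space set set \<Rightarrow> bool" where
  "weakly_balanced_graph \<C> \<longleftrightarrow>
     polyhedral_complex \<C> \<and> locally_finite_in euclidean \<C> \<and> pure_dimensional 1 \<C> \<and>
     (\<forall>w. \<forall>p\<in>\<Union>\<C>.
        (\<forall>e\<in>incident_edges \<C> p. \<forall>v\<in>outward_vectors p e. w \<bullet> v = 0) \<or>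
        (\<exists>e\<in>incident_edges \<C> p. \<exists>f\<in>incident_edges \<C> p.
           \<exists>v\<^sub>e\<in>outward_vectors p e. \<exists>v\<^sub>f\<in>outward_vectors p f. w \<bullet> v\<^sub>e < 0 \<and> 0 < w \<bullet> v\<^sub>f))"

(* The degree k is an integer, as for the library's homology groups, which vanish in negative
   degrees (also the reduced ones, and also for the empty space). *)
definition k_convex :: "int \<Rightarrow> 'a::euclidean_space set \<Rightarrow> bool" where
  "k_convex k X \<longleftrightarrow>
     open X \<and>
     (\<forall>L. affine L \<and> aff_dim L = k + 1 \<longrightarrow>
        inj_on (hom_induced k (top_of_set (L \<inter> X)) {} (top_of_set X) {} id)
          (carrier (reduced_homology_group k (top_of_set (L \<inter> X)))))"

end

theory Submission
  imports Defs
begin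

text \<open>
  Let n be the dimension and H the upper closed half-space of the hyperplane L. A class of
  degree n - 1 in the complement of a closed set B is detected by its winding numbers around the points
  of B, which are locally constant on B and vanish far away; hence that homology group is trivial as
  soon as B has no nonempty compact relatively clopen subset. Weak balance excludes such subsets of
  the part of the graph in H: at a highest point no edge leaves the top level, and a farthest point
  of the top level is then unbalanced in the radial direction. The same holds for the part below L.
  Excision turns these two vanishing statements into injectivity of the two inclusions of the slice
  of the complement into its lower half and of the lower half into the whole complement.
\<close>

section \<open>Maps in homology induced by inclusions\<close>

abbreviation hgrp :: "int \<Rightarrow> 'a::topological_space set \<Rightarrow> 'a chain set monoid" where
  "hgrp p S \<equiv> homology_group p (top_of_set S)"

abbreviation incl :: "int \<Rightarrow> 'a::topological_space set \<Rightarrow> 'a set \<Rightarrow> 'a chain set \<Rightarrow> 'a chain set" where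
  "incl p S T \<equiv> hom_induced p (top_of_set S) {} (top_of_set T) {} id"

lemma incl_compose:
  assumes "S \<subseteq> T" "T \<subseteq> U"
  shows "incl p T U (incl p S T u) = incl p S U u"
proof -
  have "incl p S U = hom_induced p (top_of_set S) {} (top_of_set U) {} (id \<circ> id)"
    by simp
  also have "\<dots> = incl p T U \<circ> incl p S T"
    using assms by (intro hom_induced_compose_empty) (auto simp: continuous_map_in_subtopology)
  finally show ?thesis by simp
qed

lemma group_hom_incl: "group_hom (hgrp p S) (hgrp p T) (incl p S T)"
  by (simp add: group_hom_def group_hom_axioms_def hom_induced_hom)

lemma incl_one [simp]: "incl p S T \<one>\<^bsub>hgrp p S\<^esub> = \<one>\<^bsub>hgrp p T\<^esub>"
  using group_hom.hom_one[OF group_hom_incl] .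

lemma incl_eq_one_trans:
  assumes "S \<subseteq> T" "T \<subseteq> U" "incl p S T u = \<one>\<^bsub>hgrp p T\<^esub>"
  shows "incl p S U u = \<one>\<^bsub>hgrp p U\<^esub>"
  by (metis assms incl_compose incl_one)

lemma incl_eq_one_through_trivial:
  assumes "S \<subseteq> T" "T \<subseteq> U" "trivial_group (hgrp p T)"
  shows "incl p S U u = \<one>\<^bsub>hgrp p U\<^esub>"
proof (rule incl_eq_one_trans[OF assms(1,2)])
  have "incl p S T u \<in> carrier (hgrp p T)"
    by (simp add: hom_induced_carrier)
  then show "incl p S T u = \<one>\<^bsub>hgrp p T\<^esub>"
    using assms(3) by (auto simp: trivial_group_def)
qed

lemma trivial_homologyI:
  assumes "\<And>u. u \<in> carrier (hgrp p S) \<Longrightarrow> u = \<one>\<^bsub>hgrp p S\<^esub>"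
  shows "trivial_group (hgrp p S)"
proof -
  have "\<one>\<^bsub>hgrp p S\<^esub> \<in> carrier (hgrp p S)"
    by (intro monoid.one_closed group.is_monoid group_relative_homology_group)
  then have "carrier (hgrp p S) = {\<one>\<^bsub>hgrp p S\<^esub>}"
    using assms by blast
  then show ?thesis
    unfolding trivial_group_def by (intro conjI group_relative_homology_group)
qed

lemma inj_on_incl_iff:
  "inj_on (incl p S T) (carrier (hgrp p S)) \<longleftrightarrow>
     (\<forall>u\<in>carrier (hgrp p S). incl p S T u = \<one>\<^bsub>hgrp p T\<^esub> \<longrightarrow> u = \<one>\<^bsub>hgrp p S\<^esub>)"
  unfolding Ball_def by (rule group_hom.inj_on_one_iff[OF group_hom_incl])

text \<open>By functoriality, a map back to S whose restriction to S is homotopic to the identity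
  induces a left inverse of the inclusion. All retraction arguments below take this form.\<close>

lemma inj_on_incl_homotopy_left_inverse:
  assumes "S \<subseteq> T" "continuous_on T f" "f \<in> T \<rightarrow> S" "homotopic_with_canon (\<lambda>x. True) S S f id"
  shows "inj_on (incl p S T) (carrier (hgrp p S))"
proof (rule inj_on_inverseI)
  fix u assume u: "u \<in> carrier (hgrp p S)"
  have "hom_induced p (top_of_set T) {} (top_of_set S) {} f (incl p S T u)
      = hom_induced p (top_of_set S) {} (top_of_set S) {} (f \<circ> id) u"
    by (rule hom_induced_compose') (use assms in \<open>auto simp: continuous_map_in_subtopology\<close>)
  also have "\<dots> = hom_induced p (top_of_set S) {} (top_of_set S) {} id u"
    using homology_homotopy_empty[OF assms(4)] by simp
  also have "\<dots> = u"
    using u by (rule hom_induced_id)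
  finally show "hom_induced p (top_of_set T) {} (top_of_set S) {} f (incl p S T u) = u" .
qed

lemma trivial_homology_contractible:
  assumes "contractible S" "p \<noteq> 0"
  shows "trivial_group (hgrp p S)"
  using trivial_reduced_homology_group_contractible_space[of "top_of_set S" p] assms
  by (simp add: un_reduced_homology_group)

text \<open>A nonempty contractible S has a constant self-map homotopic to the identity, and a
  constant extends to any superset. Degree 0, where the group of S itself is nontrivial, is
  included; it occurs when the ambient space is a plane.\<close>

lemma inj_on_incl_contractible:
  assumes "S \<subseteq> T" "contractible S"
  shows "inj_on (incl p S T) (carrier (hgrp p S))"
proof (cases "S = {}")
  case True
  then have "trivial_group (hgrp p S)"
    by (intro trivial_homology_group_empty) simp
  then show ?thesis by (auto simp: trivial_group_def)
next
  case False
  obtain a where a: "homotopic_with_canon (\<lambda>x. True) S S id (\<lambda>x. a)"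
    using assms(2) by (auto simp: contractible_def)
  with False have "a \<in> S"
    using homotopic_with_imp_funspace2 by fastforce
  then show ?thesis
    using a assms(1) by (intro inj_on_incl_homotopy_left_inverse[of S T "\<lambda>x. a"])
      (auto simp: homotopic_with_symD)
qed

section \<open>Exact sequences of pairs, Mayer-Vietoris and compact supports\<close>

lemma inj_on_incl_if_trivial_relative:
  assumes "S \<subseteq> T" "trivial_group (relative_homology_group (p + 1) (top_of_set T) S)"
  shows "inj_on (incl p S T) (carrier (hgrp p S))"
proof -
  have "exact_seq ([hgrp p T, hgrp p S, relative_homology_group (p + 1) (top_of_set T) S],
      [incl p S T, hom_boundary (p + 1) (top_of_set T) S])"
    using homology_exactness_axiom_2[of "p + 1" "top_of_set T" S] assms(1)
    by (simp add: subtopology_subtopology Int_absorb1)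
  then have "kernel (hgrp p S) (hgrp p T) (incl p S T)
      = hom_boundary (p + 1) (top_of_set T) S ` carrier (relative_homology_group (p + 1) (top_of_set T) S)"
    by simp
  also have "\<dots> = {\<one>\<^bsub>hgrp p S\<^esub>}"
    using assms hom_one[OF hom_boundary_hom[of "p + 1" "top_of_set T" S]]
    by (simp add: trivial_group_def subtopology_subtopology Int_absorb1)
  finally show ?thesis
    using group_hom.inj_iff_trivial_ker[OF group_hom_incl] by blast
qed

text \<open>Injectivity kills the image of the boundary map, so every relative class lies in its
  kernel, which by exactness is the image of the trivial group of T.\<close>

lemma trivial_relative_if_trivial_inj:
  assumes "S \<subseteq> T" "trivial_group (hgrp (p + 1) T)" "inj_on (incl p S T) (carrier (hgrp p S))"
  shows "trivial_group (relative_homology_group (p + 1) (top_of_set T) S)"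
proof -
  let ?R = "relative_homology_group (p + 1) (top_of_set T) S"
  have 1: "exact_seq ([hgrp p S, ?R, hgrp (p + 1) T],
      [hom_boundary (p + 1) (top_of_set T) S, hom_induced (p + 1) (top_of_set T) {} (top_of_set T) S id])"
    using homology_exactness_axiom_1[of "p + 1" "top_of_set T" S] assms(1)
    by (simp add: subtopology_subtopology Int_absorb1)
  have 2: "exact_seq ([hgrp p T, hgrp p S, ?R],
      [incl p S T, hom_boundary (p + 1) (top_of_set T) S])"
    using homology_exactness_axiom_2[of "p + 1" "top_of_set T" S] assms(1)
    by (simp add: subtopology_subtopology Int_absorb1)
  have "hom_boundary (p + 1) (top_of_set T) S ` carrier ?R = kernel (hgrp p S) (hgrp p T) (incl p S T)"
    using 2 by simp
  also have "\<dots> = {\<one>\<^bsub>hgrp p S\<^esub>}"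
    using assms(3) group_hom.inj_iff_trivial_ker[OF group_hom_incl] by blast
  finally have "hom_boundary (p + 1) (top_of_set T) S ` carrier ?R = {\<one>\<^bsub>hgrp p S\<^esub>}" .
  then have "kernel ?R (hgrp p S) (hom_boundary (p + 1) (top_of_set T) S) = carrier ?R"
    by (auto simp: kernel_def)
  moreover have "kernel ?R (hgrp p S) (hom_boundary (p + 1) (top_of_set T) S) = {\<one>\<^bsub>?R\<^esub>}"
    using 1 assms(2) hom_one[OF hom_induced_hom[of "p + 1" "top_of_set T" "{}" "top_of_set T" S id]]
    by (simp add: trivial_group_def)
  ultimately show ?thesis
    by (simp add: trivial_group_def)
qed

text \<open>The part of the Mayer-Vietoris sequence needed below, derived from excision: u is the
  boundary of a relative class a of (S, S \<inter> T). Pushed into (S \<union> T, T), a has zero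
  boundary in T, so it comes from the trivial group of S \<union> T and is zero.\<close>

lemma Mayer_Vietoris_injectivity:
  assumes "openin (top_of_set (S \<union> T)) S" "openin (top_of_set (S \<union> T)) T"
    and triv: "trivial_group (hgrp (p + 1) (S \<union> T))"
    and u: "u \<in> carrier (hgrp p (S \<inter> T))"
    and uS: "incl p (S \<inter> T) S u = \<one>\<^bsub>hgrp p S\<^esub>" and uT: "incl p (S \<inter> T) T u = \<one>\<^bsub>hgrp p T\<^esub>"
  shows "u = \<one>\<^bsub>hgrp p (S \<inter> T)\<^esub>"
proof -
  let ?RS = "relative_homology_group (p + 1) (top_of_set S) (S \<inter> T)"
  let ?RU = "relative_homology_group (p + 1) (top_of_set (S \<union> T)) T"
  let ?ex = "hom_induced (p + 1) (top_of_set S) (S \<inter> T) (top_of_set (S \<union> T)) T id"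
  let ?dS = "hom_boundary (p + 1) (top_of_set S) (S \<inter> T)"
  let ?dU = "hom_boundary (p + 1) (top_of_set (S \<union> T)) T"
  have [simp]: "subtopology (top_of_set S) (S \<inter> T) = top_of_set (S \<inter> T)"
       "subtopology (top_of_set (S \<union> T)) T = top_of_set T"
    by (simp_all add: subtopology_subtopology Int_absorb1)
  have "exact_seq ([hgrp p S, hgrp p (S \<inter> T), ?RS], [incl p (S \<inter> T) S, ?dS])"
    using homology_exactness_axiom_2[of "p + 1" "top_of_set S" "S \<inter> T"] by simp
  then have "kernel (hgrp p (S \<inter> T)) (hgrp p S) (incl p (S \<inter> T) S) = ?dS ` carrier ?RS"
    by simp
  moreover have "u \<in> kernel (hgrp p (S \<inter> T)) (hgrp p S) (incl p (S \<inter> T) S)"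
    using u uS by (simp add: kernel_def)
  ultimately obtain a where a: "a \<in> carrier ?RS" "u = ?dS a"
    by blast
  \<comment> \<open>Excision of T - S: it is closed in the union because S is open, and T is its own
    interior because T is open.\<close>
  have ex: "?ex \<in> iso ?RS ?RU"
  proof -
    have clo: "closedin (top_of_set (S \<union> T)) (T - S)"
      using closedin_diff[OF closedin_topspace assms(1)] by (simp add: Un_Diff)
    have "top_of_set (S \<union> T) closure_of (T - S) \<subseteq> top_of_set (S \<union> T) interior_of T"
      using assms(2) by (simp add: closure_of_closedin[OF clo] interior_of_openin) 
    then have "hom_induced (p + 1) (subtopology (top_of_set (S \<union> T)) ((S \<union> T) - (T - S))) (T - (T - S))
        (subtopology (top_of_set (S \<union> T)) (S \<union> T)) T id
      \<in> iso (relative_homology_group (p + 1) (subtopology (top_of_set (S \<union> T)) ((S \<union> T) - (T - S))) (T - (T - S)))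
          (relative_homology_group (p + 1) (subtopology (top_of_set (S \<union> T)) (S \<union> T)) T)"
      by (rule homology_excision_axiom) auto
    moreover have "(S \<union> T) - (T - S) = S" "T - (T - S) = S \<inter> T" by auto
    ultimately show ?thesis
      by (simp add: subtopology_subtopology Int_absorb1)
  qed
  have "?dU (?ex a) = incl p (S \<inter> T) T (?dS a)"
    using naturality_hom_induced[of "top_of_set S" "top_of_set (S \<union> T)" id "S \<inter> T" T "p + 1"]
    by (auto simp: o_def fun_eq_iff continuous_map_in_subtopology)
  then have "?dU (?ex a) = \<one>\<^bsub>hgrp p T\<^esub>"
    using a uT by simp
  moreover have exa: "?ex a \<in> carrier ?RU"
    by (rule hom_induced_carrier)
  ultimately have "?ex a \<in> kernel ?RU (hgrp p T) ?dU"
    by (simp add: kernel_def)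
  moreover have "exact_seq ([hgrp p T, ?RU, hgrp (p + 1) (S \<union> T)],
      [?dU, hom_induced (p + 1) (top_of_set (S \<union> T)) {} (top_of_set (S \<union> T)) T id])"
    using homology_exactness_axiom_1[of "p + 1" "top_of_set (S \<union> T)" T] by simp
  ultimately have "?ex a = \<one>\<^bsub>?RU\<^esub>"
    using triv hom_one[OF hom_induced_hom[of "p + 1" "top_of_set (S \<union> T)" "{}" "top_of_set (S \<union> T)" T id]]
    by (simp add: trivial_group_def)
  moreover have "inj_on ?ex (carrier ?RS)"
    using ex by (simp add: iso_def bij_betw_def)
  moreover have "group_hom ?RS ?RU ?ex"
    by (simp add: group_hom_def group_hom_axioms_def hom_induced_hom)
  ultimately have "a = \<one>\<^bsub>?RS\<^esub>"
    using a(1) by (simp add: group_hom.inj_on_one_iff)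
  then show ?thesis
    using a hom_one[OF hom_boundary_hom[of "p + 1" "top_of_set S" "S \<inter> T"]] by simp
qed

text \<open>A cycle involves only finitely many singular simplices; it is still a cycle in the union
  K of their compact images.\<close>

lemma homology_compact_support:
  assumes "u \<in> carrier (hgrp p S)"
  obtains K k where "compact K" "K \<subseteq> S" "k \<in> carrier (hgrp p K)" "incl p K S k = u"
proof (cases "p < 0")
  \<comment> \<open>In negative degrees the groups are trivial, so the empty set serves as
    support.\<close>
  case True
  have 1: "\<one>\<^bsub>hgrp p {}\<^esub> \<in> carrier (hgrp p ({} :: 'a set))"
    by (intro monoid.one_closed group.is_monoid group_relative_homology_group)
  have 2: "incl p {} S \<one>\<^bsub>hgrp p {}\<^esub> = u"
    using True assms incl_one[of p "{}" S] trivial_relative_homology_group[of p "top_of_set S" "{}"]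
    unfolding trivial_group_def by blast
  show ?thesis
    by (rule that[OF compact_empty empty_subsetI 1 2])
next
  case False
  then obtain n where p: "p = int n"
    using zero_le_imp_eq_int by force
  obtain c where c: "singular_relcycle n (top_of_set S) {} c"
      and u: "u = homologous_rel_set n (top_of_set S) {} c"
    using assms unfolding p carrier_relative_homology_group by auto
  define K where "K = (\<Union>f\<in>Poly_Mapping.keys c. f ` standard_simplex n)"
  have sing: "singular_simplex n (top_of_set S) f" if "f \<in> Poly_Mapping.keys c" for f
    using c that by (auto simp: singular_relcycle_def singular_chain_def)
  have "compact (f ` standard_simplex n)" if "f \<in> Poly_Mapping.keys c" for f
  proof -
    have "compactin (top_of_set S) (f ` standard_simplex n)"
      using sing[OF that] unfolding singular_simplex_def
      by (metis compactin_standard_simplex compactin_subtopology image_compactin order_refl)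
    then show ?thesis
      by (simp add: compactin_subtopology)
  qed
  then have "compact K"
    unfolding K_def by (intro compact_UN) auto
  have KS: "K \<subseteq> S"
    using sing unfolding K_def
    by (fastforce simp: singular_simplex_def continuous_map_def)
  have cK: "singular_relcycle n (top_of_set K) {} c"
  proof -
    have "singular_simplex n (top_of_set K) f" if "f \<in> Poly_Mapping.keys c" for f
      using sing[OF that] that unfolding singular_simplex_def K_def
      by (auto simp: continuous_map_in_subtopology)
    then have "singular_chain n (top_of_set K) c"
      by (auto simp: singular_chain_def)
    moreover have "chain_boundary n c = 0"
      using c by (simp add: singular_cycle)
    ultimately show ?thesis
      by (simp add: singular_cycle)
  qed
  have "incl p K S (homologous_rel_set n (top_of_set K) {} c) = homologous_rel_set n (top_of_set S) {} (chain_map n id c)"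
    unfolding p using KS cK
    by (intro hom_induced_chain_map) (auto simp: continuous_map_in_subtopology)
  also have "chain_map n id c = c"
    using c by (intro chain_map_id_gen[of n "top_of_set S"]) (auto simp: singular_relcycle_def)
  finally have "incl p K S (homologous_rel_set n (top_of_set K) {} c) = u"
    unfolding u .
  moreover have "homologous_rel_set n (top_of_set K) {} c \<in> carrier (hgrp p K)"
    unfolding p carrier_relative_homology_group using cK by blast
  ultimately show ?thesis
    using that[OF \<open>compact K\<close> KS] by blast
qed

section \<open>Complements of closed sets in degree n - 1\<close>

text \<open>The punctured space is homotopy equivalent to a sphere of dimension
  \<open>DIM('a) - 1\<close>, and p is positive and larger than that dimension.\<close>

lemma trivial_homology_punctured:
  fixes x :: "'a::euclidean_space"
  assumes "int DIM('a) \<le> p"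
  shows "trivial_group (hgrp p (- {x}))"
proof -
  have "sphere x 1 homotopy_eqv UNIV - {x}"
    using homotopy_eqv_rel_frontier_punctured_affine_hull[of "cball x 1" x]
    by (simp add: rel_frontier_nonempty_interior rel_interior_nonempty_interior affine_hull_nonempty_interior)
  moreover have "(sphere 0 1 :: 'a set) homeomorphic sphere x 1"
    by (simp add: homeomorphic_spheres)
  \<comment> \<open>The homology of spheres is known for the model \<open>nsphere\<close>; the
    orthonormal basis identifies that model with the unit sphere of the space.\<close>
  moreover obtain f :: "(nat \<Rightarrow> real) \<Rightarrow> 'a" and g
    where "homeomorphic_maps (nsphere (DIM('a) - 1)) (top_of_set (sphere 0 1 \<inter> span Basis)) f g"
    using homeomorphic_maps_nsphere_euclidean_sphere[OF independent_Basis orthogonal_Basis refl]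
    by (metis DIM_positive norm_Basis less_numeral_extra(3))
  then have "nsphere (DIM('a) - 1) homeomorphic_space top_of_set (sphere 0 1 :: 'a set)"
    unfolding homeomorphic_space_def by auto
  then have "nsphere (DIM('a) - 1) homotopy_equivalent_space top_of_set (sphere 0 1 :: 'a set)"
    by (rule homeomorphic_imp_homotopy_equivalent_space)
  ultimately have "nsphere (DIM('a) - 1) homotopy_equivalent_space top_of_set (- {x})"
    unfolding Compl_eq_Diff_UNIV
    by (meson homeomorphic_imp_homotopy_eqv homotopy_eqv_trans)
  then have "hgrp p (- {x}) \<cong> homology_group p (nsphere (DIM('a) - 1))"
    by (metis homotopy_equivalent_space_imp_isomorphic_homology_groups homotopy_equivalent_space_sym)
  moreover have "trivial_group (homology_group p (nsphere (DIM('a) - 1)))"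
  proof -
    have "p \<noteq> 0" "p \<noteq> int (DIM('a) - 1)"
      using assms DIM_positive[where 'a='a] by linarith+
    then show ?thesis
      using reduced_homology_group_nsphere(2)[of p "DIM('a) - 1"] by (simp add: un_reduced_homology_group)
  qed
  ultimately show ?thesis
    by (simp add: isomorphic_group_triviality)
qed

text \<open>Reduces vanishing off a whole starlike set to vanishing off its center: the winding
  number around x alone decides.\<close>

lemma inj_on_incl_starlike_complement:
  fixes x :: "'a::euclidean_space"
  assumes "bounded K" "x \<in> K" and star: "\<And>y. y \<in> K \<Longrightarrow> closed_segment x y \<subseteq> K"
  shows "inj_on (incl p (- K) (- {x})) (carrier (hgrp p (- K)))"
proof -
  obtain R where R: "0 < R" "K \<subseteq> ball x R"
    using bounded_subset_ballD[OF assms(1)] by blast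
  \<comment> \<open>This factor moves points closer to x than R out to distance R and fixes all
    others.\<close>
  define l where "l = (\<lambda>y. max 1 (R / norm (y - x)))"
  define f where "f = (\<lambda>y. x + l y *\<^sub>R (y - x))"
  \<comment> \<open>the left inverse f pushes points radially away from x, out of a ball containing K\<close>
  have push: "x + t *\<^sub>R (y - x) \<notin> K" if "y \<notin> K" "1 \<le> t" for y t
  proof
    assume "x + t *\<^sub>R (y - x) \<in> K"
    then have "closed_segment x (x + t *\<^sub>R (y - x)) \<subseteq> K"
      by (rule star)
    moreover have "y \<in> closed_segment x (x + t *\<^sub>R (y - x))"
      unfolding in_segment using that(2)
      by (intro exI[of _ "1 / t"]) (auto simp: algebra_simps)
    ultimately show False
      using that(1) by blast
  qed
  have contl: "continuous_on (- {x}) l"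
    unfolding l_def by (intro continuous_intros) auto
  have contf: "continuous_on (- {x}) f"
    unfolding f_def by (intro continuous_intros contl)
  have fK: "f y \<notin> K" if "y \<noteq> x" for y
  proof -
    have "R \<le> l y * norm (y - x)"
      using that by (simp add: l_def max_def field_simps)
    then have "R \<le> dist x (f y)"
      by (simp add: f_def dist_norm l_def)
    then show ?thesis
      using R(2) by auto
  qed
  \<comment> \<open>The straight-line homotopy from f to the identity uses only radial factors at
    least 1, so it stays outside K.\<close>
  have "closed_segment (f y) y \<subseteq> - K" if "y \<in> - K" for y
  proof
    fix z assume "z \<in> closed_segment (f y) y"
    then obtain s where s: "0 \<le> s" "s \<le> 1" "z = (1 - s) *\<^sub>R f y + s *\<^sub>R y"
      by (auto simp: in_segment)
    have "z = x + ((1 - s) * l y + s) *\<^sub>R (y - x)"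
      by (simp add: s f_def algebra_simps)
    moreover have "1 \<le> (1 - s) * l y + s"
      using mult_left_mono[of 1 "l y" "1 - s"] s by (simp add: l_def)
    ultimately show "z \<in> - K"
      using push that by auto
  qed
  moreover have sub: "- K \<subseteq> - {x}"
    using assms(2) by auto
  moreover have "f \<in> - {x} \<rightarrow> - K"
    using fK by auto
  ultimately have "homotopic_with_canon (\<lambda>x. True) (- K) (- K) f id"
    using contf by (intro homotopic_with_linear) (auto intro: continuous_on_subset)
  then show ?thesis
    using sub contf \<open>f \<in> _\<close> by (rule inj_on_incl_homotopy_left_inverse[rotated 3])
qed

text \<open>Mayer-Vietoris induction on the number of sets, splitting off one set K. The degree must
  vary: the connecting term lies in degree p + 1, which is why p is only bounded below.\<close>

lemma homology_complement_convex_union_eq_one: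
  fixes \<F> :: "'a::euclidean_space set set"
  assumes "finite \<F>" "\<And>K. K \<in> \<F> \<Longrightarrow> compact K \<and> convex K"
    and "2 \<le> DIM('a)" "int DIM('a) - 1 \<le> p" "u \<in> carrier (hgrp p (- \<Union>\<F>))"
    and "\<And>x. x \<in> \<Union>\<F> \<Longrightarrow> incl p (- \<Union>\<F>) (- {x}) u = \<one>\<^bsub>hgrp p (- {x})\<^esub>"
  shows "u = \<one>\<^bsub>hgrp p (- \<Union>\<F>)\<^esub>"
  using assms(1,2,4-)
proof (induction "card \<F>" arbitrary: \<F> p u rule: less_induct)
  case less
  have pos: "p \<noteq> 0"
    using less.prems(3) assms(3) by linarith
  show ?case
  proof (cases "\<F> = {}")
    case True
    moreover have "trivial_group (hgrp p (UNIV :: 'a set))"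
      using pos by (intro trivial_homology_contractible) (auto intro: convex_imp_contractible)
    ultimately show ?thesis
      using less.prems(4) by (simp add: trivial_group_def)
  next
    case False
    then obtain K \<G> where K: "K \<notin> \<G>" "\<F> = insert K \<G>"
      by (meson Set.set_insert ex_in_conv)
    have fin: "finite \<G>" and comp: "compact K" and conv: "convex K"
      and G: "\<And>G. G \<in> \<G> \<Longrightarrow> compact G \<and> convex G"
      using less.prems K by auto
    have card: "card \<G> < card \<F>"
      using K fin by simp
    have clo: "closed (\<Union>\<G>)" "closed K"
      using fin G comp by (auto intro!: closed_Union compact_imp_closed)
    \<comment> \<open>The union of the two complements is the complement of the pairwise
      intersections with K, which are again compact and convex and fewer than the original
      sets.\<close>
    define \<H> where "\<H> = (\<inter>) K ` \<G>"
    have H: "- K \<union> - \<Union>\<G> = - \<Union>\<H>" "- K \<inter> - \<Union>\<G> = - \<Union>\<F>"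
      by (auto simp: \<H>_def K(2))
    \<comment> \<open>In degree p + 1 the hypothesis on points is automatic, since punctured space
      has no homology there.\<close>
    have "v = \<one>\<^bsub>hgrp (p + 1) (- \<Union>\<H>)\<^esub>" if v: "v \<in> carrier (hgrp (p + 1) (- \<Union>\<H>))" for v
    proof (rule less.hyps)
      show "card \<H> < card \<F>" "finite \<H>"
        using card card_image_le[OF fin, of "(\<inter>) K"] fin by (auto simp: \<H>_def)
      show "compact H \<and> convex H" if "H \<in> \<H>" for H
        using that comp conv G by (auto simp: \<H>_def compact_Int convex_Int)
      show "int DIM('a) - 1 \<le> p + 1"
        using less.prems(3) by simp
      show "incl (p + 1) (- \<Union>\<H>) (- {x}) v = \<one>\<^bsub>hgrp (p + 1) (- {x})\<^esub>" if "x \<in> \<Union>\<H>" for x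
        using that less.prems(3)
        by (intro incl_eq_one_through_trivial[of _ "- {x}"] trivial_homology_punctured) auto
    qed (rule v)
    then have triv: "trivial_group (hgrp (p + 1) (- K \<union> - \<Union>\<G>))"
      unfolding H by (rule trivial_homologyI)
    have inG: "incl p (- \<Union>\<F>) (- \<Union>\<G>) u = \<one>\<^bsub>hgrp p (- \<Union>\<G>)\<^esub>"
    proof (rule less.hyps[OF card fin G less.prems(3)])
      show "incl p (- \<Union>\<F>) (- \<Union>\<G>) u \<in> carrier (hgrp p (- \<Union>\<G>))"
        by (rule hom_induced_carrier)
      show "incl p (- \<Union>\<G>) (- {x}) (incl p (- \<Union>\<F>) (- \<Union>\<G>) u) = \<one>\<^bsub>hgrp p (- {x})\<^esub>" if "x \<in> \<Union>\<G>" for x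
        using that less.prems(5)[of x] K(2) by (subst incl_compose) auto
    qed
    \<comment> \<open>For a single convex set any of its points detects the class. The set may be
      empty, as intersections enter the induction; then the complement is the whole space.\<close>
    have inK: "incl p (- \<Union>\<F>) (- K) u = \<one>\<^bsub>hgrp p (- K)\<^esub>"
    proof (cases "K = {}")
      case True
      then show ?thesis
        using pos by (intro incl_eq_one_through_trivial[OF _ order_refl] trivial_homology_contractible)
          (auto intro: convex_imp_contractible)
    next
      case False
      then obtain x where x: "x \<in> K" by blast
      have "inj_on (incl p (- K) (- {x})) (carrier (hgrp p (- K)))"
        using comp conv x
        by (intro inj_on_incl_starlike_complement) (auto simp: compact_imp_bounded closed_segment_subset)
      moreover have "incl p (- K) (- {x}) (incl p (- \<Union>\<F>) (- K) u) = \<one>\<^bsub>hgrp p (- {x})\<^esub>"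
        using x less.prems(5)[of x] K(2) by (subst incl_compose) auto
      ultimately show ?thesis
        unfolding inj_on_incl_iff by (meson hom_induced_carrier)
    qed
    have "openin (top_of_set (- K \<union> - \<Union>\<G>)) (- K)" "openin (top_of_set (- K \<union> - \<Union>\<G>)) (- \<Union>\<G>)"
      using clo by (auto intro!: open_openin_trans)
    from Mayer_Vietoris_injectivity[OF this triv, unfolded H(2)] show ?thesis
      using less.prems(4) inK inG by blast
  qed
qed

(* If u is supported in the compact set S inside an open ball Q, the compact set consisting of the
   part of B in Q and the sphere bounding Q is covered by finitely many balls avoiding S. Adding the sphere
   is harmless because u vanishes in Q, and it makes Q - B a retract of the remaining complement. *)
lemma homology_closed_complement_eq_one:
  fixes B :: "'a::euclidean_space set"
  assumes "closed B" "2 \<le> DIM('a)" "int DIM('a) - 1 \<le> p" and u: "u \<in> carrier (hgrp p (- B))"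
    and zero: "\<And>x. x \<in> B \<Longrightarrow> incl p (- B) (- {x}) u = \<one>\<^bsub>hgrp p (- {x})\<^esub>"
  shows "u = \<one>\<^bsub>hgrp p (- B)\<^esub>"
proof -
  have pos: "p \<noteq> 0"
    using assms(2,3) by linarith
  obtain S k where S: "compact S" "S \<subseteq> - B" and k: "k \<in> carrier (hgrp p S)" "incl p S (- B) k = u"
    using homology_compact_support[OF u] by metis
  obtain r where r: "0 < r" "S \<subseteq> ball 0 r"
    using bounded_subset_ballD[OF compact_imp_bounded[OF S(1)]] by blast
  define B' where "B' = (B \<inter> cball 0 r) \<union> sphere 0 r"
  have "compact B'"
    unfolding B'_def using assms(1) by (intro compact_Un closed_Int_compact) auto
  have zero': "incl p S (- {x}) k = \<one>\<^bsub>hgrp p (- {x})\<^esub>" if "x \<in> B'" for x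
  proof (cases "x \<in> B")
    case True
    have "incl p S (- {x}) k = incl p (- B) (- {x}) (incl p S (- B) k)"
      using True S(2) by (intro incl_compose[symmetric]) auto
    then show ?thesis
      using zero[OF True] k(2) by simp
  next
    case False
    then have "x \<notin> ball 0 r"
      using that by (auto simp: B'_def)
    then show ?thesis
      using r(2) pos
      by (intro incl_eq_one_through_trivial[of _ "ball 0 r"] trivial_homology_contractible convex_imp_contractible) auto
  qed
  have SB': "S \<inter> B' = {}"
    using S(2) r(2) by (auto simp: B'_def)
  have "\<exists>e>0. cball b e \<inter> S = {}" if "b \<in> B'" for b
  proof -
    have "open (- S)" "b \<in> - S"
      using that SB' compact_imp_closed[OF S(1)] by auto
    then show ?thesis
      by (meson disjoint_eq_subset_Compl open_contains_cball)
  qed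
  then obtain e where e: "\<And>b. b \<in> B' \<Longrightarrow> 0 < e b \<and> cball b (e b) \<inter> S = {}"
    by metis
  obtain D where D: "D \<subseteq> B'" "finite D" "B' \<subseteq> (\<Union>b\<in>D. ball b (e b))"
    using compactE_image[OF \<open>compact B'\<close>, of B' "\<lambda>b. ball b (e b)"] e by force
  define \<F> where "\<F> = (\<lambda>b. cball b (e b)) ` D"
  have SF: "S \<subseteq> - \<Union>\<F>"
    using e D(1) by (fastforce simp: \<F>_def)
  have BF: "- \<Union>\<F> \<subseteq> - B'"
  proof -
    have "(\<Union>b\<in>D. ball b (e b)) \<subseteq> \<Union>\<F>"
      by (auto simp: \<F>_def)
    then show ?thesis
      using D(3) by blast
  qed
  have "incl p S (- \<Union>\<F>) k = \<one>\<^bsub>hgrp p (- \<Union>\<F>)\<^esub>"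
  proof (rule homology_complement_convex_union_eq_one[OF _ _ assms(2,3)])
    show "finite \<F>" "\<And>K. K \<in> \<F> \<Longrightarrow> compact K \<and> convex K"
      using D(2) by (auto simp: \<F>_def)
    show "incl p S (- \<Union>\<F>) k \<in> carrier (hgrp p (- \<Union>\<F>))"
      by (rule hom_induced_carrier)
    \<comment> \<open>The center b lies in \<open>B'\<close>, so the class vanishes off b, hence off
      the whole ball around b, hence off the point x of that ball.\<close>
    fix x assume "x \<in> \<Union>\<F>"
    then obtain b where b: "b \<in> D" "x \<in> cball b (e b)"
      by (auto simp: \<F>_def)
    then have eb: "0 < e b" "S \<subseteq> - cball b (e b)" "b \<in> B'"
      using e D(1) by blast+
    have "inj_on (incl p (- cball b (e b)) (- {b})) (carrier (hgrp p (- cball b (e b))))"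
      using eb(1) by (intro inj_on_incl_starlike_complement closed_segment_subset) auto
    moreover have "incl p (- cball b (e b)) (- {b}) (incl p S (- cball b (e b)) k) = \<one>\<^bsub>hgrp p (- {b})\<^esub>"
      using zero'[OF eb(3)] eb(1,2) by (subst incl_compose) auto
    ultimately have "incl p S (- cball b (e b)) k = \<one>\<^bsub>hgrp p (- cball b (e b))\<^esub>"
      unfolding inj_on_incl_iff by (meson hom_induced_carrier)
    then have "incl p S (- {x}) k = \<one>\<^bsub>hgrp p (- {x})\<^esub>"
      using eb(2) b(2) by (intro incl_eq_one_trans[of S "- cball b (e b)" "- {x}"]) auto
    then show "incl p (- \<Union>\<F>) (- {x}) (incl p S (- \<Union>\<F>) k) = \<one>\<^bsub>hgrp p (- {x})\<^esub>"
      using SF \<open>x \<in> \<Union>\<F>\<close> by (subst incl_compose) auto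
  qed
  then have kB': "incl p S (- B') k = \<one>\<^bsub>hgrp p (- B')\<^esub>"
    by (rule incl_eq_one_trans[OF SF BF])
  define W where "W = ball 0 r - B"
  have W: "S \<subseteq> W" "W \<subseteq> - B'" "W \<subseteq> - B"
    using S(2) r(2) by (auto simp: W_def B'_def)
  have "incl p S W k = \<one>\<^bsub>hgrp p W\<^esub>"
  proof (cases "W = {}")
    case True
    then have "trivial_group (hgrp p W)"
      by (intro trivial_homology_group_empty) simp
    then show ?thesis
      by (rule incl_eq_one_through_trivial[OF W(1) order_refl])
  next
    case False
    then obtain a where a: "a \<in> W" by blast
    \<comment> \<open>Continuous because removing the sphere separates the remaining complement into
      two disjoint open pieces; the outer one is sent to an arbitrary point a of W.\<close>
    define f where "f = (\<lambda>x. if x \<in> ball 0 r then x else a)"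
    have *: "- B' = W \<union> - cball 0 r"
      by (auto simp: W_def B'_def)
    have "continuous_on W f"
      by (rule continuous_on_eq[OF continuous_on_id]) (simp add: f_def W_def)
    moreover have "continuous_on (- cball 0 r) f"
      by (rule continuous_on_eq[OF continuous_on_const[of _ a]]) (simp add: f_def)
    ultimately have "continuous_on (- B') f"
      unfolding * W_def using assms(1) by (intro continuous_on_open_Un) auto
    moreover have "homotopic_with_canon (\<lambda>x. True) W W f id"
      by (rule homotopic_with_eq[OF iffD2[OF homotopic_with_refl]]) (auto simp: f_def W_def)
    ultimately have "inj_on (incl p W (- B')) (carrier (hgrp p W))"
      using W(2) a by (intro inj_on_incl_homotopy_left_inverse[of W "- B'" f]) (auto simp: f_def * W_def)
    moreover have "incl p W (- B') (incl p S W k) = \<one>\<^bsub>hgrp p (- B')\<^esub>"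
      using kB' W by (subst incl_compose) auto
    ultimately show ?thesis
      unfolding inj_on_incl_iff by (meson hom_induced_carrier)
  qed
  then have "incl p S (- B) k = \<one>\<^bsub>hgrp p (- B)\<^esub>"
    by (rule incl_eq_one_trans[OF W(1,3)])
  then show ?thesis
    using k(2) by simp
qed

text \<open>The points of B with nonzero winding number form a compact relatively open subset of B,
  which is empty by hypothesis; then no point of B detects the class.\<close>

lemma trivial_homology_closed_complement:
  fixes B :: "'a::euclidean_space set"
  assumes "closed B" "2 \<le> DIM('a)" "int DIM('a) - 1 \<le> p"
    and clopen: "\<And>K. compact K \<Longrightarrow> K \<subseteq> B \<Longrightarrow> openin (top_of_set B) K \<Longrightarrow> K = {}"
  shows "trivial_group (hgrp p (- B))"
proof (rule trivial_homologyI)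
  fix u assume u: "u \<in> carrier (hgrp p (- B))"
  have pos: "p \<noteq> 0"
    using assms(2,3) by linarith
  obtain S k where S: "compact S" "S \<subseteq> - B" and k: "k \<in> carrier (hgrp p S)" "incl p S (- B) k = u"
    using homology_compact_support[OF u] by metis
  obtain r where r: "0 < r" "S \<subseteq> ball 0 r"
    using bounded_subset_ballD[OF compact_imp_bounded[OF S(1)]] by blast
  have inclB: "incl p (- B) (- {x}) u = incl p S (- {x}) k" if "x \<in> B" for x
    using that k(2)[symmetric] S(2) by (auto simp: incl_compose)
  define K where "K = {x \<in> B. incl p S (- {x}) k \<noteq> \<one>\<^bsub>hgrp p (- {x})\<^esub>}"
  \<comment> \<open>A small ball around x misses the support S. For each y in it, vanishing around y
    is equivalent to vanishing off the whole ball, a condition independent of y.\<close>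
  have local_const: "\<exists>e>0. \<forall>y\<in>B \<inter> ball x e. y \<in> K \<longleftrightarrow> x \<in> K" if x: "x \<in> B" for x
  proof -
    have "open (- S)" "x \<in> - S"
      using S x by (auto simp: compact_imp_closed)
    then obtain e where e: "0 < e" "S \<subseteq> - cball x e"
      by (metis compl_le_swap1 open_contains_cball)
    have "incl p S (- {y}) k = \<one>\<^bsub>hgrp p (- {y})\<^esub> \<longleftrightarrow> incl p S (- cball x e) k = \<one>\<^bsub>hgrp p (- cball x e)\<^esub>"
      if "y \<in> cball x e" for y
    proof -
      have "inj_on (incl p (- cball x e) (- {y})) (carrier (hgrp p (- cball x e)))"
        using that by (intro inj_on_incl_starlike_complement closed_segment_subset) auto
      moreover have "incl p (- cball x e) (- {y}) (incl p S (- cball x e) k) = incl p S (- {y}) k"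
        using that e(2) by (intro incl_compose) auto
      ultimately show ?thesis
        unfolding inj_on_incl_iff by (metis hom_induced_carrier incl_one)
    qed
    then have "\<forall>y\<in>B \<inter> ball x e. y \<in> K \<longleftrightarrow> x \<in> K"
      using x e(1) by (auto simp: K_def)
    then show ?thesis
      using e(1) by blast
  qed
  have "openin (top_of_set B) K"
    unfolding openin_euclidean_subtopology_iff
  proof (intro conjI ballI)
    fix x assume "x \<in> K"
    then show "\<exists>e>0. \<forall>x'\<in>B. dist x' x < e \<longrightarrow> x' \<in> K"
      using local_const[of x] by (auto simp: K_def dist_commute)
  qed (auto simp: K_def)
  moreover have "compact K"
  proof -
    \<comment> \<open>For x outside this ball, the support lies in a contractible set missing x, so
      the class vanishes around x.\<close>
    have "x \<in> ball 0 r" if "x \<in> K" for x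
    proof (rule ccontr)
      assume "x \<notin> ball 0 r"
      then have "incl p S (- {x}) k = \<one>\<^bsub>hgrp p (- {x})\<^esub>"
        using r(2) pos
        by (intro incl_eq_one_through_trivial[of _ "ball 0 r"] trivial_homology_contractible convex_imp_contractible) auto
      then show False
        using that by (simp add: K_def)
    qed
    then have "bounded K"
      by (meson bounded_ball bounded_subset subsetI)
    moreover have "openin (top_of_set B) (B - K)"
      unfolding openin_euclidean_subtopology_iff
    proof (intro conjI ballI)
      fix x assume "x \<in> B - K"
      then show "\<exists>e>0. \<forall>x'\<in>B. dist x' x < e \<longrightarrow> x' \<in> B - K"
        using local_const[of x] by (auto simp: dist_commute)
    qed auto
    then have "closedin (top_of_set B) K"
      by (auto simp: closedin_def K_def)
    ultimately show ?thesis
      using closedin_closed_trans[OF _ assms(1)] by (auto simp: compact_eq_bounded_closed)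
  qed
  ultimately have "K = {}"
    by (intro clopen) (auto simp: K_def)
  then show "u = \<one>\<^bsub>hgrp p (- B)\<^esub>"
    using inclB by (intro homology_closed_complement_eq_one[OF assms(1-3) u]) (auto simp: K_def)
qed

section \<open>Cutting along a hyperplane\<close>

(* Y is the complement of the upper half of B, and its lower half D is starlike, so the pair (Y, D) has
   trivial homology; excising the rest of B from it gives the pair in question. *)
lemma inj_on_incl_halfspace:
  fixes B :: "'a::euclidean_space set"
  assumes "closed B" "w \<noteq> 0" and triv: "trivial_group (hgrp (p + 1) (- (B \<inter> {x. c \<le> w \<bullet> x})))"
  shows "inj_on (incl p (- B \<inter> {x. w \<bullet> x \<le> c}) (- B)) (carrier (hgrp p (- B \<inter> {x. w \<bullet> x \<le> c})))"
proof -
  define Y where "Y = - (B \<inter> {x. c \<le> w \<bullet> x})"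
  define D where "D = Y \<inter> {x. w \<bullet> x \<le> c}"
  define U where "U = Y \<inter> B"
  have "starlike D"
    unfolding starlike_def
  proof (intro bexI ballI)
    \<comment> \<open>A point at level c - 1. Every point of a segment from a to x other than x has
      level strictly below c, where nothing was removed from Y; D itself need not be convex, because
      of the holes at level c.\<close>
    define a where "a = ((c - 1) / (w \<bullet> w)) *\<^sub>R w"
    have a: "w \<bullet> a = c - 1"
      using assms(2) by (simp add: a_def)
    then show "a \<in> D"
      by (simp add: D_def Y_def)
    fix x assume x: "x \<in> D"
    show "closed_segment a x \<subseteq> D"
    proof
      fix z assume "z \<in> closed_segment a x"
      then obtain s where s: "0 \<le> s" "s \<le> 1" "z = (1 - s) *\<^sub>R a + s *\<^sub>R x"
        by (auto simp: in_segment)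
      show "z \<in> D"
      proof (cases "s = 1")
        case True
        then show ?thesis using s x by simp
      next
        case False
        have "s * (w \<bullet> x) \<le> s * c"
          using x s by (intro mult_left_mono) (auto simp: D_def)
        moreover have "w \<bullet> z = (1 - s) * (c - 1) + s * (w \<bullet> x)"
          by (simp add: s(3) inner_add_right a)
        ultimately have "w \<bullet> z < c"
          using s(2) False by (simp add: algebra_simps)
        then show ?thesis
          by (simp add: D_def Y_def)
      qed
    qed
  qed
  have DY: "D \<subseteq> Y"
    by (simp add: D_def)
  have inj: "inj_on (incl p D Y) (carrier (hgrp p D))"
    by (rule inj_on_incl_contractible[OF DY starlike_imp_contractible[OF \<open>starlike D\<close>]])
  have "trivial_group (relative_homology_group (p + 1) (top_of_set Y) D)"
    by (rule trivial_relative_if_trivial_inj[OF DY triv[folded Y_def] inj])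
  moreover have "relative_homology_group (p + 1) (top_of_set (- B)) (- B \<inter> {x. w \<bullet> x \<le> c})
      \<cong> relative_homology_group (p + 1) (top_of_set Y) D"
  proof -
    have clo: "closedin (top_of_set Y) U"
      unfolding U_def using assms(1) by (rule closedin_closed_Int)
    \<comment> \<open>The excised set U is the part of B strictly below level c, hence inside the
      interior of D relative to Y, as excision demands.\<close>
    have "openin (top_of_set Y) (Y \<inter> {x. w \<bullet> x < c})"
      by (intro openin_open_Int open_halfspace_lt)
    moreover have "Y \<inter> {x. w \<bullet> x < c} \<subseteq> D"
      by (auto simp: D_def)
    moreover have "U \<subseteq> Y \<inter> {x. w \<bullet> x < c}"
      by (auto simp: U_def Y_def)
    ultimately have "top_of_set Y closure_of U \<subseteq> top_of_set Y interior_of D"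
      unfolding closure_of_closedin[OF clo] by (meson interior_of_maximal order_trans)
    then have "hom_induced (p + 1) (subtopology (top_of_set Y) (Y - U)) (D - U) (subtopology (top_of_set Y) Y) D id
      \<in> iso (relative_homology_group (p + 1) (subtopology (top_of_set Y) (Y - U)) (D - U))
          (relative_homology_group (p + 1) (subtopology (top_of_set Y) Y) D)"
      by (rule homology_excision_axiom[OF _ DY])
    moreover have "Y - U = - B" "D - U = - B \<inter> {x. w \<bullet> x \<le> c}"
      by (auto simp: D_def U_def Y_def)
    moreover have "subtopology (top_of_set Y) (- B) = top_of_set (- B)"
      by (simp add: subtopology_subtopology Y_def Int_absorb1)
    moreover have "subtopology (top_of_set Y) Y = top_of_set Y"
      by (simp add: subtopology_subtopology)
    ultimately show ?thesis
      unfolding is_iso_def by (metis empty_iff)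
  qed
  ultimately have "trivial_group (relative_homology_group (p + 1) (top_of_set (- B)) (- B \<inter> {x. w \<bullet> x \<le> c}))"
    by (simp add: isomorphic_group_triviality)
  then show ?thesis
    by (rule inj_on_incl_if_trivial_relative[OF Int_lower1])
qed

text \<open>The lower half \<open>?X\<close> embeds injectively into the complement of B by the
  half-space lemma. For the slice \<open>?P\<close> in \<open>?X\<close>, the space above is
  exchanged: in the complement of \<open>B'\<close> the slice is a retract of the upper half
  \<open>?Z\<close>, and \<open>?Z\<close> embeds injectively there. So a class of \<open>?P\<close>
  dying in \<open>?X\<close> dies in the complement of \<open>B'\<close>, hence in
  \<open>?Z\<close>, hence is zero.\<close>

lemma inj_on_incl_hyperplane:
  fixes B :: "'a::euclidean_space set"
  assumes "closed B" "w \<noteq> 0"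
    and up: "trivial_group (hgrp (p + 1) (- (B \<inter> {x. c \<le> w \<bullet> x})))"
    and down: "trivial_group (hgrp (p + 1) (- (B \<inter> {x. w \<bullet> x \<le> c})))"
  shows "inj_on (incl p (- B \<inter> {x. w \<bullet> x = c}) (- B)) (carrier (hgrp p (- B \<inter> {x. w \<bullet> x = c})))"
proof -
  define \<pi> where "\<pi> = (\<lambda>x. x - ((w \<bullet> x - c) / (w \<bullet> w)) *\<^sub>R w)"
  have cont: "continuous_on S \<pi>" for S
    unfolding \<pi>_def using assms(2) by (intro continuous_intros) auto
  have \<pi>L: "w \<bullet> \<pi> x = c" for x
    using assms(2) by (simp add: \<pi>_def inner_diff_right)
  have \<pi>id: "\<pi> x = x" if "w \<bullet> x = c" for x
    using that by (simp add: \<pi>_def)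
  \<comment> \<open>the upper half of B is replaced by the cylinder over its trace on the hyperplane\<close>
  define B' where "B' = (B \<inter> {x. w \<bullet> x \<le> c}) \<union> ({x. c \<le> w \<bullet> x} \<inter> \<pi> -` B)"
  let ?P = "- B \<inter> {x. w \<bullet> x = c}" and ?X = "- B \<inter> {x. w \<bullet> x \<le> c}" and ?Z = "- B' \<inter> {x. - w \<bullet> x \<le> - c}"
  have "closed B'"
    unfolding B'_def using assms(1) cont
    by (intro closed_Un closed_Int closed_halfspace_le closed_halfspace_ge closed_vimage)
  \<comment> \<open>The half-space lemma for -w only sees the part of \<open>B'\<close> at levels at
    most c. The cylinder adds nothing there, since \<pi> fixes the hyperplane; thus
    \<open>down\<close> applies.\<close>
  moreover have "B' \<inter> {x. - c \<le> - w \<bullet> x} = B \<inter> {x. w \<bullet> x \<le> c}"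
    using \<pi>id by (auto simp: B'_def)
  ultimately have injZ: "inj_on (incl p ?Z (- B')) (carrier (hgrp p ?Z))"
    using assms(2) down by (intro inj_on_incl_halfspace) auto
  have injP: "inj_on (incl p ?P ?Z) (carrier (hgrp p ?P))"
  proof (rule inj_on_incl_homotopy_left_inverse)
    show "?P \<subseteq> ?Z" "\<pi> \<in> ?Z \<rightarrow> ?P"
      using \<pi>id \<pi>L by (auto simp: B'_def)
    show "homotopic_with_canon (\<lambda>x. True) ?P ?P \<pi> id"
      by (rule homotopic_with_equal) (use \<pi>id \<pi>L cont in auto)
  qed (rule cont)
  have injX: "inj_on (incl p ?X (- B)) (carrier (hgrp p ?X))"
    by (rule inj_on_incl_halfspace[OF assms(1,2) up])
  have PXB': "?P \<subseteq> ?X" "?X \<subseteq> - B'" "?P \<subseteq> ?Z" "?Z \<subseteq> - B'" "?X \<subseteq> - B"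
    using \<pi>id by (auto simp: B'_def)
  show ?thesis
    unfolding inj_on_incl_iff
  proof (intro ballI impI)
    fix u assume u: "u \<in> carrier (hgrp p ?P)" and "incl p ?P (- B) u = \<one>\<^bsub>hgrp p (- B)\<^esub>"
    then have "incl p ?X (- B) (incl p ?P ?X u) = \<one>\<^bsub>hgrp p (- B)\<^esub>"
      using PXB' by (subst incl_compose) auto
    then have "incl p ?P ?X u = \<one>\<^bsub>hgrp p ?X\<^esub>"
      using injX unfolding inj_on_incl_iff by (meson hom_induced_carrier)
    then have "incl p ?P (- B') u = \<one>\<^bsub>hgrp p (- B')\<^esub>"
      by (rule incl_eq_one_trans[OF PXB'(1,2)])
    then have "incl p ?Z (- B') (incl p ?P ?Z u) = \<one>\<^bsub>hgrp p (- B')\<^esub>"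
      using PXB' by (subst incl_compose) auto
    then have "incl p ?P ?Z u = \<one>\<^bsub>hgrp p ?Z\<^esub>"
      using injZ unfolding inj_on_incl_iff by (meson hom_induced_carrier)
    then show "u = \<one>\<^bsub>hgrp p ?P\<^esub>"
      using injP u unfolding inj_on_incl_iff by blast
  qed
qed

section \<open>Weakly balanced graphs\<close>

lemma closed_weakly_balanced_graph:
  assumes "weakly_balanced_graph \<C>"
  shows "closed (\<Union>\<C>)"
proof -
  have "closedin euclidean (\<Union>\<C>)"
  proof (rule closedin_locally_finite_Union)
    show "\<And>\<sigma>. \<sigma> \<in> \<C> \<Longrightarrow> closedin euclidean \<sigma>"
      using assms by (auto simp: weakly_balanced_graph_def polyhedral_complex_def polyhedron_imp_closed)
    show "locally_finite_in euclidean \<C>"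
      using assms by (simp add: weakly_balanced_graph_def)
  qed
  then show ?thesis by simp
qed

text \<open>Half of a subdivided edge need not be a cell, but for drawing segments a convex cell
  containing it suffices.\<close>

lemma incident_edge_convex:
  assumes "polyhedral_complex \<C>" "e \<in> incident_edges \<C> p"
  obtains e' where "e' \<in> \<C>" "convex e'" "p \<in> e'" "e \<subseteq> e'"
proof -
  have "\<exists>e'\<in>edges \<C>. p \<in> e' \<and> e \<subseteq> e'"
    using assms(2) unfolding incident_edges_def
  proof (elim UnE)
    assume "e \<in> {insert p h |h e. e \<in> edges \<C> \<and> p \<in> rel_interior e \<and> h \<in> components (e - {p})}"
    then obtain h e' where *: "e = insert p h" "e' \<in> edges \<C>" "p \<in> rel_interior e'" "h \<in> components (e' - {p})"
      by blast
    then have "p \<in> e'" "h \<subseteq> e'"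
      using rel_interior_subset[of e'] in_components_subset[of h "e' - {p}"] by auto
    with * show ?thesis by blast
  qed auto
  then obtain e' where "e' \<in> \<C>" "p \<in> e'" "e \<subseteq> e'"
    by (auto simp: edges_def)
  moreover from this have "convex e'"
    using assms(1) polyhedron_imp_convex by (auto simp: polyhedral_complex_def)
  ultimately show ?thesis
    using that by blast
qed

lemma outward_segment_subset:
  assumes "polyhedral_complex \<C>" "e \<in> incident_edges \<C> p" "v \<in> outward_vectors p e"
  obtains t where "0 < t" "closed_segment p (p + t *\<^sub>R v) \<subseteq> \<Union>\<C>"
proof -
  obtain t where t: "0 < t" "p + t *\<^sub>R v \<in> e"
    using assms(3) by (auto simp: outward_vectors_def)
  obtain e' where e': "e' \<in> \<C>" "convex e'" "p \<in> e'" "e \<subseteq> e'"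
    by (rule incident_edge_convex[OF assms(1,2)])
  then have "closed_segment p (p + t *\<^sub>R v) \<subseteq> e'"
    using t(2) by (intro closed_segment_subset) auto
  then show ?thesis
    using that t(1) e'(1) by blast
qed

text \<open>Purity excludes isolated points. Without an outward vector the orthogonality alternative
  of weak balance could hold vacuously.\<close>

lemma exists_outward_vector:
  assumes "weakly_balanced_graph \<C>" "p \<in> \<Union>\<C>"
  obtains e v where "e \<in> incident_edges \<C> p" "v \<in> outward_vectors p e"
proof -
  have pure: "pure_dimensional 1 \<C>"
    using assms(1) by (simp add: weakly_balanced_graph_def)
  obtain \<sigma> where \<sigma>: "\<sigma> \<in> \<C>" "p \<in> \<sigma>"
    using assms(2) by blast
  obtain V where V: "p \<in> V" "finite {\<tau> \<in> \<C>. \<tau> \<inter> V \<noteq> {}}"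
    using assms(1) unfolding weakly_balanced_graph_def locally_finite_in_def
    by (metis UNIV_I topspace_euclidean)
  then have "finite {\<tau> \<in> \<C>. p \<in> \<tau>}"
    by (intro finite_subset[OF _ V(2)]) auto
  \<comment> \<open>By local finiteness a maximal cell through p exists. It is maximal in the whole
    complex, since any larger cell also contains p; so purity gives it dimension one.\<close>
  then obtain e where e: "e \<in> \<C>" "p \<in> e" and max: "\<And>\<tau>. \<tau> \<in> \<C> \<Longrightarrow> p \<in> \<tau> \<Longrightarrow> e \<subseteq> \<tau> \<Longrightarrow> e = \<tau>"
    using finite_has_maximal[of "{\<tau> \<in> \<C>. p \<in> \<tau>}"] \<sigma> by auto
  have dim: "aff_dim e = 1"
    using pure e max unfolding pure_dimensional_def by blast
  then have edge: "e \<in> edges \<C>"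
    using e by (simp add: edges_def)
  have "e \<noteq> {p}"
    using dim by auto
  then have ne: "e - {p} \<noteq> {}"
    using e(2) by blast
  then obtain q where q: "q \<in> e" "q \<noteq> p"
    by blast
  have out: "q - p \<in> outward_vectors p e'" if "q \<in> e'" for e'
    using that q(2) by (auto simp: outward_vectors_def intro!: exI[of _ 1])
  show ?thesis
  proof (cases "p \<in> rel_interior e")
    case False
    then have "e \<in> incident_edges \<C> p"
      using edge e(2) by (simp add: incident_edges_def)
    then show ?thesis
      using that out q(1) by blast
  next
    case True
    define h where "h = connected_component_set (e - {p}) q"
    have "h \<in> components (e - {p})" "q \<in> h"
      using q by (auto simp: h_def componentsI)
    then have "insert p h \<in> incident_edges \<C> p"
      using edge True unfolding incident_edges_def by blast
    then show ?thesis
      using that out \<open>q \<in> h\<close> by blast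
  qed
qed

(* At a highest point of K no edge leaves the top level, so a farthest top point would again be
   unbalanced, this time in the radial direction. *)
lemma weakly_balanced_upper_half_no_clopen:
  assumes wb: "weakly_balanced_graph \<C>"
    and K: "compact K" "K \<subseteq> \<Union>\<C> \<inter> {x. c \<le> w \<bullet> x}" "openin (top_of_set (\<Union>\<C> \<inter> {x. c \<le> w \<bullet> x})) K"
  shows "K = {}"
proof (rule ccontr)
  assume "K \<noteq> {}"
  define B where "B = \<Union>\<C> \<inter> {x. c \<le> w \<bullet> x}"
  have pc: "polyhedral_complex \<C>"
    using wb by (simp add: weakly_balanced_graph_def)
  have KB: "openin (top_of_set B) K" "closedin (top_of_set B) K"
    using K by (auto simp: B_def intro: closed_subset compact_imp_closed)
  \<comment> \<open>The segment lies in B because half-spaces are convex, and being connected it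
    cannot leave the relatively clopen set K.\<close>
  have stay: "y \<in> K" if "p \<in> K" "closed_segment p y \<subseteq> \<Union>\<C>" "c \<le> w \<bullet> y" for p y
  proof -
    have "p \<in> B" "y \<in> \<Union>\<C>"
      using that K(2) by (auto simp: B_def)
    then have "closed_segment p y \<subseteq> {x. c \<le> w \<bullet> x}"
      using that(3) convex_halfspace_ge[of c w]
      by (intro closed_segment_subset) (auto simp: B_def)
    then have "closed_segment p y \<subseteq> B"
      using that(2) by (auto simp: B_def)
    moreover obtain T T' where "open T" "closed T'" "K = B \<inter> T" "K = B \<inter> T'"
      using KB by (auto simp: openin_open closedin_closed)
    ultimately have "closed_segment p y \<inter> K = closed_segment p y \<inter> T"
        "closed_segment p y \<inter> K = closed_segment p y \<inter> T'" "open T" "closed T'"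
      by auto
    then have "openin (top_of_set (closed_segment p y)) (closed_segment p y \<inter> K)"
        "closedin (top_of_set (closed_segment p y)) (closed_segment p y \<inter> K)"
      by (metis openin_open, metis closedin_closed)
    then have "closed_segment p y \<inter> K = closed_segment p y"
      using connected_segment[of p y] \<open>p \<in> K\<close> unfolding connected_clopen by blast
    then show ?thesis by auto
  qed
  obtain m where m: "m \<in> K" "\<And>x. x \<in> K \<Longrightarrow> w \<bullet> x \<le> w \<bullet> m"
    using continuous_attains_sup[OF K(1) \<open>K \<noteq> {}\<close>
        continuous_on_inner[OF continuous_on_const[of K w] continuous_on_id]] by blast
  define F where "F = K \<inter> {x. w \<bullet> x = w \<bullet> m}"
  have F: "compact F" "F \<noteq> {}"
    using compact_Int_closed[OF K(1) closed_hyperplane] m(1) by (auto simp: F_def)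
  obtain p where p: "p \<in> F" "\<And>x. x \<in> F \<Longrightarrow> norm x \<le> norm p"
    using continuous_attains_sup[OF F continuous_on_norm_id] by blast
  have pK: "p \<in> K" "w \<bullet> p = w \<bullet> m" "c \<le> w \<bullet> p" "p \<in> \<Union>\<C>"
    using p(1) K(2) by (auto simp: F_def)
  have balance: "(\<forall>e\<in>incident_edges \<C> p. \<forall>v\<in>outward_vectors p e. u \<bullet> v = 0) \<or>
      (\<exists>f\<in>incident_edges \<C> p. \<exists>v\<in>outward_vectors p f. 0 < u \<bullet> v)" for u
    using wb pK(4) unfolding weakly_balanced_graph_def by blast
  \<comment> \<open>Following an upward edge from p stays in the half-space, hence in K, and would
    exceed the maximal level.\<close>
  have not_up: "\<not> 0 < w \<bullet> v" if ev: "e \<in> incident_edges \<C> p" "v \<in> outward_vectors p e" for e v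
  proof
    assume pos: "0 < w \<bullet> v"
    obtain t where t: "0 < t" "closed_segment p (p + t *\<^sub>R v) \<subseteq> \<Union>\<C>"
      by (rule outward_segment_subset[OF pc ev])
    have up: "w \<bullet> p < w \<bullet> (p + t *\<^sub>R v)"
      using pos t(1) by (simp add: inner_add_right)
    then have "p + t *\<^sub>R v \<in> K"
      using pK(3) by (intro stay[OF pK(1) t(2)]) linarith
    then show False
      using m(2)[of "p + t *\<^sub>R v"] pK(2) up by linarith
  qed
  then have level: "w \<bullet> v = 0" if "e \<in> incident_edges \<C> p" "v \<in> outward_vectors p e" for e v
    using balance[of w] that by blast
  obtain e0 v0 where "e0 \<in> incident_edges \<C> p" "v0 \<in> outward_vectors p e0"
    by (rule exists_outward_vector[OF wb pK(4)])
  \<comment> \<open>Either all outward vectors are orthogonal to p and \<open>v0\<close> serves, or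
    balance with respect to p itself supplies one with positive product.\<close>
  then obtain e v where ev: "e \<in> incident_edges \<C> p" "v \<in> outward_vectors p e" "0 \<le> p \<bullet> v"
    using balance[of p] by (metis less_imp_le order_refl)
  obtain t where t: "0 < t" "closed_segment p (p + t *\<^sub>R v) \<subseteq> \<Union>\<C>"
    by (rule outward_segment_subset[OF pc ev(1,2)])
  have wt: "w \<bullet> (p + t *\<^sub>R v) = w \<bullet> p"
    by (simp add: inner_add_right level[OF ev(1,2)])
  then have "p + t *\<^sub>R v \<in> F"
    using pK(2,3) stay[OF pK(1) t(2)] by (simp add: F_def)
  then have "(norm (p + t *\<^sub>R v))\<^sup>2 \<le> (norm p)\<^sup>2"
    using p(2) by (simp add: power_mono)
  \<comment> \<open>The cross term is nonnegative and the last term positive, so the new point of F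
    is farther from the origin than p.\<close>
  moreover have "(norm (p + t *\<^sub>R v))\<^sup>2 = (norm p)\<^sup>2 + 2 * t * (p \<bullet> v) + t\<^sup>2 * (norm v)\<^sup>2"
    unfolding power2_norm_eq_inner
    by (simp add: power2_eq_square algebra_simps inner_commute)
  moreover have "0 \<le> 2 * t * (p \<bullet> v)" "0 < t\<^sup>2 * (norm v)\<^sup>2"
    using t(1) ev(2,3) by (auto simp: outward_vectors_def)
  ultimately show False
    by linarith
qed

theorem theorem2p5:
  fixes \<C> :: "(real ^ 'n) set set"
  assumes "weakly_balanced_graph \<C>"
  shows "k_convex (int CARD('n) - 2) (- \<Union>\<C>)"
  unfolding k_convex_def
proof (intro conjI allI impI)
  let ?p = "int CARD('n) - 2" and ?B = "\<Union>\<C>"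
  have clo: "closed ?B"
    by (rule closed_weakly_balanced_graph[OF assms])
  then show "open (- ?B)"
    by (rule open_Compl)
  fix L :: "(real ^ 'n) set"
  assume L: "affine L \<and> aff_dim L = ?p + 1"
  show "inj_on (incl ?p (L \<inter> - ?B) (- ?B)) (carrier (reduced_homology_group ?p (top_of_set (L \<inter> - ?B))))"
  proof (cases "CARD('n) = 1")
    \<comment> \<open>On the line the degree is -1, where the reduced group is trivial.\<close>
    case True
    then show ?thesis
      using trivial_reduced_homology_group[of ?p "top_of_set (L \<inter> - ?B)"]
      by (simp add: trivial_group_def)
  next
    case False
    then have "2 \<le> CARD('n)"
      using zero_less_card_finite[where 'a = 'n] by linarith
    then have dim: "2 \<le> DIM(real ^ 'n)"
      by simp
    obtain w c where w: "w \<noteq> 0" "L = {x. w \<bullet> x = c}"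
      using L aff_dim_eq_hyperplane[of L] by (auto simp: hull_same)
    have half: "trivial_group (hgrp (?p + 1) (- (?B \<inter> {x. d \<le> u \<bullet> x})))" for u d
    proof (rule trivial_homology_closed_complement[OF _ dim])
      show "closed (?B \<inter> {x. d \<le> u \<bullet> x})"
        using clo by (intro closed_Int closed_halfspace_ge)
    qed (use weakly_balanced_upper_half_no_clopen[OF assms] in auto)
    have "inj_on (incl ?p (- ?B \<inter> {x. w \<bullet> x = c}) (- ?B)) (carrier (hgrp ?p (- ?B \<inter> {x. w \<bullet> x = c})))"
      \<comment> \<open>The lower half for w is the upper half for -w at level -c.\<close>
      using half[of c w] half[of "- c" "- w"] by (intro inj_on_incl_hyperplane[OF clo w(1)]) auto
    then show ?thesis
      \<comment> \<open>Reduced homology is a subset of unreduced homology, so injectivity restricts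
        to it.\<close>
      unfolding w(2) Int_commute[of _ "- ?B"]
      by (rule inj_on_subset[OF _ carrier_reduced_homology_group_subset])
  qed
qed

end
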